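(* Suppose the kernel $K$ is nonnegative and let $u\ne0$ be a bounded solution of $$Lu-\nu u+n(u)=0$$ with supercritical wave speed $\nu>\mathfrak m(0)$. If $n$ is homogeneous (that is, $n=n_q$), then $u$ has a one-sided profile with $\operatorname{sgn}u=\operatorname{sgn}\gamma$ almost everywhere. The same conclusion also holds for inhomogeneous $n$ when $\|u\|_\infty$ is sufficiently small (that is, there is $\delta>0$ such that it holds whenever $\|u\|_\infty<\delta$).
   Context: Notation. $\langle\xi\rangle=\sqrt{1+\xi^2}$; $\mathscr F(\varphi)(\xi)=\widehat\varphi(\xi)=\frac1{\sqrt{2\pi}}\int_{\mathbb R}\varphi(x)e^{-i\xi x}\,dx$. $A\lesssim B$ means $A\le cB$ for a constant $c>0$ independent of $A$ and $B$. Functions are real-valued on $\mathbb R$; $\|\cdot\|_\infty$ is the $L^\infty$ norm. Standing assumptions. (A1) $L$ is a Fourier multiplier operator, $\widehat{Lu}=\mathfrak m\,\widehat u$, with even symbol $\mathfrak m:\mathbb R\to\mathbb R$ satisfying $|\mathfrak m(\xi)|\lesssim\langle\xi\rangle^{\sigma}$ for some $\sigma<0$; the kernel $K:=\mathscr F^{-1}(\mathfrak m)$ belongs to $L^1(\mathbb R)$, so that $Lu=\frac1{\sqrt{2\pi}}K*u$ (this defines $Lu$ for bounded $u$); $\mathfrak m$ has a strictly positive unique global maximum at $0$ and is $C^{2\ell}$ around $0$ for some $\ell\in\mathbb Z_+$ (positive integer), with $\mathfrak m^{(2\ell)}(0)<0$ and Maclaurin expansion $\mathfrak m(\xi)=\mathfrak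 m(0)+\frac{\mathfrak m^{(2\ell)}(0)}{(2\ell)!}\xi^{2\ell}+O(|\xi|^{2\ell+2})$. (A2) $n:\mathbb R\to\mathbb R$ is locally Lipschitz and $n=n_q+n_{\mathrm r}$, where $q\in(0,4\ell)$ and either $n_q(x)=\gamma|x|^{1+q}$ with a constant $\gamma\ne0$, or $n_q(x)=\gamma x|x|^q$ with $\gamma>0$. If $n\in C^\varsigma_{\mathrm{loc}}$ for some real $\varsigma<1+q$, then $n_{\mathrm r}^{(j)}(x)=o(|x|^{1+q-j})$ as $x\to0$ for all $j=0,1,\dots,\lfloor\varsigma\rfloor$ (in particular $n^{(j)}(x)=O(|x|^{1+q-j})$ for these $j$). When $n$ is merely locally Lipschitz it is assumed that $n'(x)=O(|x|^q)$ almost everywhere as $x\to0$. ($C^\varsigma_{\mathrm{loc}}$ is the usual local Hölder class; a locally Lipschitz $n$ lies in it for every $\varsigma\in(0,1)$.)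
   Formalization: For n_q = γx|x|^q the formal theorem also assumes u ≥ 0 almost everywhere, in both halves; without it the claim fails, since the constant u = -((ν-m(0))/γ)^{1/q} is a bounded solution of the homogeneous equation with sgn u ≠ sgn γ. *)

theory Defs
  imports "HOL-Probability.Probability" "HOL-Library.Landau_Symbols"
begin

text \<open>Functions on the real line that matter only up to null sets (the kernel and the solution) are
  represented by Borel functions; every Lebesgue measurable function has a Borel representative.\<close>

definition japanese :: "real \<Rightarrow> real" where
  "japanese \<xi> = sqrt (1 + \<xi>\<^sup>2)"

definition fourier :: "(real \<Rightarrow> real) \<Rightarrow> real \<Rightarrow> complex" where
  "fourier \<phi> \<xi> =
     complex_of_real (1 / sqrt (2 * pi)) *
     (LINT x|lborel. complex_of_real (\<phi> x) * exp (- \<i> * complex_of_real (\<xi> * x)))"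

text \<open>The operator \<open>L\<close> acting on bounded functions, \<open>L u = K * u / sqrt (2 pi)\<close>.\<close>

definition conv_op :: "(real \<Rightarrow> real) \<Rightarrow> (real \<Rightarrow> real) \<Rightarrow> real \<Rightarrow> real" where
  "conv_op K u x = 1 / sqrt (2 * pi) * (LINT y|lborel. K (x - y) * u y)"

definition Linf_norm :: "(real \<Rightarrow> real) \<Rightarrow> ereal" where
  "Linf_norm u = esssup lborel (\<lambda>x. ereal \<bar>u x\<bar>)"

definition Ck_on :: "nat \<Rightarrow> (real \<Rightarrow> real) \<Rightarrow> real set \<Rightarrow> bool" where
  "Ck_on k f S \<longleftrightarrow>
     (\<forall>j<k. \<forall>x\<in>S. ((deriv ^^ j) f) differentiable (at x)) \<and> continuous_on S ((deriv ^^ k) f)"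

text \<open>The local Hoelder class \<open>C^s\<close>, for \<open>s > 0\<close>. If \<open>s\<close> is an integer, the exponent below is \<open>0\<close>, the last
  condition follows from continuity, and the class is the usual \<open>C^s\<close>.\<close>

definition holder_loc :: "real \<Rightarrow> (real \<Rightarrow> real) \<Rightarrow> bool" where
  "holder_loc s f \<longleftrightarrow>
     (let k = nat \<lfloor>s\<rfloor> in
        Ck_on k f UNIV \<and>
        (\<forall>R. \<exists>C. \<forall>x\<in>{-R..R}. \<forall>y\<in>{-R..R}.
           \<bar>(deriv ^^ k) f x - (deriv ^^ k) f y\<bar> \<le> C * \<bar>x - y\<bar> powr (s - real k)))"

definition locally_lipschitz :: "(real \<Rightarrow> real) \<Rightarrow> bool" where
  "locally_lipschitz f \<longleftrightarrow> (\<forall>x. \<exists>r>0. \<exists>C. C-lipschitz_on (ball x r) f)"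

text \<open>The assumptions on the symbol \<open>m\<close> and the kernel \<open>K\<close>. The inverse Fourier transform defining \<open>K\<close> is
  taken in the sense of tempered distributions, since \<open>m\<close> need not be integrable; for integrable
  \<open>K\<close> it means that the Fourier transform of \<open>K\<close> is \<open>m\<close> almost everywhere.\<close>

definition dispersion_assms :: "(real \<Rightarrow> real) \<Rightarrow> (real \<Rightarrow> real) \<Rightarrow> nat \<Rightarrow> bool" where
  "dispersion_assms m K l \<longleftrightarrow>
     (\<forall>\<xi>. m (- \<xi>) = m \<xi>) \<and>
     (\<exists>\<sigma><0. \<exists>C>0. \<forall>\<xi>. \<bar>m \<xi>\<bar> \<le> C * japanese \<xi> powr \<sigma>) \<and>
     integrable lborel K \<and>
     (AE \<xi> in lborel. fourier K \<xi> = complex_of_real (m \<xi>)) \<and>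
     m 0 > 0 \<and> (\<forall>\<xi>. \<xi> \<noteq> 0 \<longrightarrow> m \<xi> < m 0) \<and>
     l \<ge> 1 \<and>
     (\<exists>\<epsilon>>0. Ck_on (2 * l) m (ball 0 \<epsilon>)) \<and>
     (deriv ^^ (2 * l)) m 0 < 0 \<and>
     (\<lambda>\<xi>. m \<xi> - (m 0 + (deriv ^^ (2 * l)) m 0 / fact (2 * l) * \<xi> ^ (2 * l)))
       \<in> O[at 0](\<lambda>\<xi>. \<bar>\<xi>\<bar> ^ (2 * l + 2))"

definition nq_even :: "real \<Rightarrow> real \<Rightarrow> real \<Rightarrow> real" where
  "nq_even \<gamma> q x = \<gamma> * \<bar>x\<bar> powr (1 + q)"

text \<open>For \<open>nq_odd\<close> the equation with \<open>n = nq\<close> is invariant under the map from \<open>u\<close> to \<open>- u\<close>, and it has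
  negative constant solutions for every \<open>\<nu> > m 0\<close>, arbitrarily small ones as \<open>\<nu>\<close> tends to \<open>m 0\<close>.
  So in that case \<open>\<gamma>\<close> cannot determine the sign of \<open>u\<close> unless negative values of \<open>u\<close> are
  excluded beforehand. The theorem adds the premise \<open>0 \<le> u\<close> almost everywhere for \<open>nq_odd\<close> only; it
  is not in the source, whose claim fails without it.\<close>

definition nq_odd :: "real \<Rightarrow> real \<Rightarrow> real \<Rightarrow> real" where
  "nq_odd \<gamma> q x = \<gamma> * x * \<bar>x\<bar> powr q"

text \<open>The assumptions on the nonlinearity; the remainder is \<open>n - nq\<close>. In the last clause,
  \<open>n\<close> being merely locally Lipschitz means that it is not \<open>C^1\<close>.\<close>

definition nonlinearity_assms ::
  "(real \<Rightarrow> real) \<Rightarrow> (real \<Rightarrow> real) \<Rightarrow> real \<Rightarrow> real \<Rightarrow> nat \<Rightarrow> bool" where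
  "nonlinearity_assms n nq \<gamma> q l \<longleftrightarrow>
     locally_lipschitz n \<and>
     0 < q \<and> q < 4 * real l \<and>
     (\<gamma> \<noteq> 0 \<and> nq = nq_even \<gamma> q \<or> \<gamma> > 0 \<and> nq = nq_odd \<gamma> q) \<and>
     (\<forall>s. 0 < s \<and> s < 1 + q \<and> holder_loc s n \<longrightarrow>
        (\<forall>j\<le>nat \<lfloor>s\<rfloor>. (deriv ^^ j) (\<lambda>x. n x - nq x) \<in> o[at 0](\<lambda>x. \<bar>x\<bar> powr (1 + q - real j)))) \<and>
     (\<not> holder_loc 1 n \<longrightarrow>
        (\<exists>C. \<exists>r>0. AE x in lborel. \<bar>x\<bar> < r \<longrightarrow>
           n differentiable (at x) \<and> \<bar>deriv n x\<bar> \<le> C * \<bar>x\<bar> powr q))"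

definition bounded_solution ::
  "(real \<Rightarrow> real) \<Rightarrow> (real \<Rightarrow> real) \<Rightarrow> real \<Rightarrow> (real \<Rightarrow> real) \<Rightarrow> bool" where
  "bounded_solution K n \<nu> u \<longleftrightarrow>
     u \<in> borel_measurable lborel \<and> Linf_norm u < \<infinity> \<and>
     (AE x in lborel. conv_op K u x - \<nu> * u x + n (u x) = 0)"

end

theory Submission
  imports Defs
begin

text \<open>The theorem is a strong maximum principle for the nonlocal operator \<open>L\<close>. On the values that
  \<open>u\<close> takes, \<open>\<gamma> * n\<close> is nonnegative: for \<open>n = nq\<close> by the form of \<open>nq\<close>, and for small values
  because the remainder is \<open>o(\<bar>x\<bar> powr (1 + q))\<close>. (For \<open>nq_odd\<close> this uses \<open>u \<ge> 0\<close>.) Hence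
  \<open>w = sgn \<gamma> * u\<close> is a supersolution of the linear equation, \<open>L w \<le> \<nu> w\<close>, and the nonlinearity
  can be forgotten.

  Since \<open>K\<close> is nonnegative, \<open>L\<close> preserves order and multiplies constants by its symbol at zero,
  \<open>m 0\<close>. A lower bound \<open>- b\<close> for \<open>w\<close> therefore improves to \<open>- (m 0 / \<nu>) b\<close>, and as \<open>m 0 < \<nu>\<close>,
  iteration gives \<open>w \<ge> 0\<close> (\<open>supersolution_nonneg\<close>).

  It remains to exclude a zero set \<open>Z\<close> of \<open>w\<close> that is neither null nor conull. Applying the
  order-preserving \<open>L\<close> twice gives \<open>L (L w) \<le> \<nu>\<^sup>2 w\<close>, so that \<open>K * K * w\<close> vanishes on \<open>Z\<close>. The
  kernel \<open>K\<close> may vanish on large sets, but the symbol is real, so \<open>K\<close> is even, and then \<open>K * K\<close>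
  is positive near \<open>0\<close> by a Steinhaus argument. Thus almost every point of \<open>Z\<close> has a neighbourhood
  of a fixed radius that lies in \<open>Z\<close> up to a null set, and \<open>Z\<close> spreads over the whole line
  (\<open>supersolution_zero_or_pos\<close>). Evenness cannot be dispensed with: for a kernel carried by the
  positive half-line a solution may vanish on one half-line and be positive on the other.\<close>

section \<open>Sets of positive measure on the line\<close>

lemma AE_lborel_ex_between:
  fixes a b :: real
  assumes "AE x in lborel. P x" and "a < b"
  shows "\<exists>x. a < x \<and> x < b \<and> P x"
proof (rule ccontr)
  assume "\<not> ?thesis"
  then have "AE x in lborel. x \<notin> {a<..<b}"
    using assms(1) by (auto elim!: eventually_mono)
  then have "{a<..<b} \<in> null_sets lborel"
    by (subst AE_iff_null_sets) auto
  then show False using \<open>a < b\<close> by (auto simp: null_sets_def)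
qed

text \<open>Steinhaus' theorem. A compact part \<open>C\<close> of \<open>P\<close> of positive measure is surrounded by an open set
  \<open>U\<close> with \<open>U - C\<close> smaller than \<open>C\<close>. A small translate of \<open>C\<close> stays in \<open>U\<close>, and being as large
  as \<open>C\<close> it does not fit into \<open>U - C\<close>, even up to a null set.\<close>

lemma positive_measure_meets_translates:
  fixes P :: "real set"
  assumes P: "P \<in> sets borel" and pos: "emeasure lborel P \<noteq> 0"
  shows "\<exists>r>0. \<forall>h. \<bar>h\<bar> < r \<longrightarrow> \<not> (AE s in lborel. \<not> (s \<in> P \<and> s + h \<in> P))"
proof -
  have "P \<in> sets lebesgue" using P by simp
  then obtain N :: "real set" and D :: "nat \<Rightarrow> real set"
    where N: "negligible N" and D: "\<And>n. compact (D n)" and PD: "P = (\<Union>n. D n) \<union> N"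
    by (rule lebesgue_regular_inner) blast
  have D_borel: "D n \<in> sets borel" for n using D by (simp add: borel_compact)
  have "\<exists>n. emeasure lborel (D n) \<noteq> 0"
  proof (rule ccontr)
    assume "\<nexists>n. emeasure lborel (D n) \<noteq> 0"
    then have "D n \<in> null_sets lebesgue" for n
      using D_borel[of n] by (simp add: null_sets_def)
    then have "P \<in> null_sets lebesgue"
      using N unfolding PD negligible_iff_null_sets by blast
    then show False using pos P by (simp add: null_sets_def)
  qed
  then obtain C where C: "compact C" and C_pos: "emeasure lborel C \<noteq> 0" and CP: "C \<subseteq> P"
    using D PD by blast
  have [measurable]: "C \<in> sets borel" using C by (simp add: borel_compact)
  have C_fin: "emeasure lborel C < \<infinity>" using C by (intro emeasure_bounded_finite compact_imp_bounded)
  have "0 < measure lborel C"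
    using C_pos C_fin by (metis emeasure_eq_ennreal_measure ennreal_0 less_irrefl measure_nonneg order_le_less infinity_ennreal_def)
  then obtain U where U: "open U" "C \<subseteq> U" and "emeasure lborel (U - C) < measure lborel C"
    using outer_regular_lborel[of C] by auto
  then have UC: "emeasure lborel (U - C) < emeasure lborel C"
    using C_fin by (simp add: emeasure_eq_ennreal_measure)
  have [measurable]: "U \<in> sets borel" using U by simp
  obtain r where r: "r > 0" "(\<Union>x\<in>C. ball x r) \<subseteq> U"
    using compact_subset_open_imp_ball_epsilon_subset[OF C U] by auto
  have "\<not> (AE s in lborel. \<not> (s \<in> P \<and> s + h \<in> P))" if h: "\<bar>h\<bar> < r" for h
  proof
    assume null: "AE s in lborel. \<not> (s \<in> P \<and> s + h \<in> P)"
    define E where "E = {s. s + h \<in> C}"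
    have [measurable]: "E \<in> sets borel" unfolding E_def by measurable
    have "E \<subseteq> U" using r h by (force simp: E_def dist_real_def)
    have "emeasure lborel C = (\<integral>\<^sup>+x. indicator C x \<partial>lborel)" by simp
    also have "\<dots> = (\<integral>\<^sup>+x. indicator C (h + 1 * x) \<partial>lborel)"
      by (subst nn_integral_real_affine[of _ 1 h]) auto
    also have "\<dots> = (\<integral>\<^sup>+x. indicator E x \<partial>lborel)"
      by (rule nn_integral_cong) (auto simp: E_def indicator_def add.commute)
    also have "\<dots> = emeasure lborel E" by simp
    also have "\<dots> \<le> emeasure lborel (U - C)"
    proof (rule emeasure_mono_AE)
      show "AE x in lborel. x \<in> E \<longrightarrow> x \<in> U - C"
        using null by eventually_elim (use CP \<open>E \<subseteq> U\<close> in \<open>auto simp: E_def\<close>)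
    qed simp
    finally show False using UC by simp
  qed
  then show ?thesis using r by blast
qed

text \<open>From one ball contained in \<open>Z\<close> up to a null set, larger concentric balls are reached by adding
  balls around points that are almost at the boundary.\<close>

lemma zero_set_spreads:
  fixes Z :: "real set"
  assumes r: "r > 0"
    and spread: "AE x in lborel. x \<in> Z \<longrightarrow> (AE z in lborel. \<bar>z - x\<bar> < r \<longrightarrow> z \<in> Z)"
  shows "(AE x in lborel. x \<in> Z) \<or> (AE x in lborel. x \<notin> Z)"
proof (rule disjCI)
  assume "\<not> (AE x in lborel. x \<notin> Z)"
  then have "\<exists>x. \<not> ((x \<in> Z \<longrightarrow> (AE z in lborel. \<bar>z - x\<bar> < r \<longrightarrow> z \<in> Z)) \<longrightarrow> x \<notin> Z)"
    using eventually_mp[OF _ spread] by (metis (mono_tags, lifting) always_eventually)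
  then obtain x0 where x0: "AE z in lborel. \<bar>z - x0\<bar> < r \<longrightarrow> z \<in> Z" by blast
  have grow: "AE z in lborel. \<bar>z - x0\<bar> < r + real n * (r / 2) \<longrightarrow> z \<in> Z" for n
  proof (induction n)
    case 0
    then show ?case using x0 by simp
  next
    case (Suc n)
    define R where "R = r + real n * (r / 2)"
    have R: "r \<le> R" using r by (simp add: R_def)
    have good: "AE x in lborel. \<bar>x - x0\<bar> < R \<longrightarrow> (AE z in lborel. \<bar>z - x\<bar> < r \<longrightarrow> z \<in> Z)"
      using Suc spread unfolding R_def by eventually_elim auto
    obtain x1 where x1: "x0 + R - r / 2 < x1" "x1 < x0 + R"
        and x1': "AE z in lborel. \<bar>z - x1\<bar> < r \<longrightarrow> z \<in> Z"
      using AE_lborel_ex_between[OF good, of "x0 + R - r / 2" "x0 + R"] r R by auto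
    obtain x2 where x2: "x0 - R < x2" "x2 < x0 - R + r / 2"
        and x2': "AE z in lborel. \<bar>z - x2\<bar> < r \<longrightarrow> z \<in> Z"
      using AE_lborel_ex_between[OF good, of "x0 - R" "x0 - R + r / 2"] r R by auto
    have "AE z in lborel. \<bar>z - x0\<bar> < R + r / 2 \<longrightarrow> z \<in> Z"
      using Suc[folded R_def] x1' x2'
    proof eventually_elim
      case (elim z)
      have "\<bar>z - x0\<bar> < R + r / 2 \<Longrightarrow> \<bar>z - x0\<bar> < R \<or> \<bar>z - x1\<bar> < r \<or> \<bar>z - x2\<bar> < r"
        using x1 x2 r R by linarith
      then show ?case using elim by blast
    qed
    then show ?case by (simp add: R_def field_simps)
  qed
  have "AE z in lborel. \<forall>n. \<bar>z - x0\<bar> < r + real n * (r / 2) \<longrightarrow> z \<in> Z"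
    unfolding AE_all_countable using grow by blast
  then show "AE z in lborel. z \<in> Z"
  proof eventually_elim
    case (elim z)
    obtain n where "\<bar>z - x0\<bar> < real n * (r / 2)"
      using reals_Archimedean3[of "r / 2"] r by auto
    then show ?case using elim[rule_format, of n] r by linarith
  qed
qed

section \<open>Mass and evenness of the kernel\<close>

lemma isCont_fourier:
  assumes K: "integrable lborel K"
  shows "isCont (fourier K) \<xi>"
  unfolding continuous_at_sequentially comp_def
proof (intro allI impI)
  fix X :: "nat \<Rightarrow> real" assume X: "X \<longlonglongrightarrow> \<xi>"
  have [measurable]: "K \<in> borel_measurable borel" using K by auto
  show "(\<lambda>n. fourier K (X n)) \<longlonglongrightarrow> fourier K \<xi>"
    unfolding fourier_def
    by (intro tendsto_mult tendsto_const
        integral_dominated_convergence[where w = "\<lambda>x. \<bar>K x\<bar>"])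
       (use K in \<open>auto intro!: tendsto_intros X simp: norm_mult\<close>)
qed

text \<open>Reflecting a probability distribution conjugates its characteristic function, so a distribution
  with real characteristic function equals its reflection by Levy's uniqueness theorem.\<close>

lemma even_if_char_real:
  fixes f :: "real \<Rightarrow> real"
  assumes f: "integrable lborel f" and f0: "AE x in lborel. 0 \<le> f x"
    and f1: "(LINT x|lborel. f x) = 1"
    and real: "\<And>t. Im (CLINT x|lborel. complex_of_real (f x) * iexp (t * x)) = 0"
  shows "AE x in lborel. f (- x) = f x"
proof -
  have [measurable]: "f \<in> borel_measurable borel" using f by auto
  define M where "M = density lborel (\<lambda>x. ennreal (f x))"
  have nn1: "(\<integral>\<^sup>+x. ennreal (f x) \<partial>lborel) = 1"
    using f f0 f1 by (subst nn_integral_eq_integral) auto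
  have M: "real_distribution M"
    unfolding real_distribution_def real_distribution_axioms_def M_def
    using nn1 by (auto intro!: prob_spaceI simp: emeasure_density)
  interpret M: real_distribution M by (rule M)
  have char_M: "char M t = (CLINT x|lborel. complex_of_real (f x) * iexp (t * x))" for t
    unfolding char_def M_def using f0
    by (subst integral_density) (auto simp: scaleR_conv_of_real)
  define M' where "M' = distr M borel uminus"
  have M': "real_distribution M'"
    unfolding M'_def by (intro M.real_distribution_distr) auto
  have "char M' t = char M t" for t
  proof -
    have "char M' t = (CLINT x|M. cnj (iexp (t * x)))"
      unfolding char_def M'_def by (subst integral_distr) (auto simp: exp_cnj)
    also have "\<dots> = cnj (char M t)" unfolding char_def by simp
    also have "\<dots> = char M t" using real[of t] by (simp add: char_M complex_eq_iff)
    finally show ?thesis .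
  qed
  then have "M' = M" by (intro Levy_uniqueness M M') auto
  moreover have "M' = density lborel (\<lambda>x. ennreal (f (- x)))"
  proof (rule measure_eqI)
    fix A assume "A \<in> sets M'"
    then have [measurable]: "A \<in> sets borel" by (simp add: M'_def)
    have [measurable]: "uminus -` A \<in> sets borel"
      by (rule measurable_sets_borel[of uminus borel]) auto
    have "emeasure M' A = (\<integral>\<^sup>+x. ennreal (f x) * indicator A (- x) \<partial>lborel)"
      unfolding M'_def M_def
      by (subst emeasure_distr) (auto simp: emeasure_density indicator_def intro!: nn_integral_cong)
    also have "\<dots> = (\<integral>\<^sup>+x. ennreal (f (- x)) * indicator A x \<partial>lborel)"
      by (subst nn_integral_real_affine[of _ "-1" 0]) auto
    finally show "emeasure M' A = emeasure (density lborel (\<lambda>x. ennreal (f (- x)))) A"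
      by (simp add: emeasure_density)
  qed (simp add: M'_def)
  ultimately have "density lborel (\<lambda>x. ennreal (f (- x))) = density lborel (\<lambda>x. ennreal (f x))"
    by (simp add: M_def)
  moreover have "AE x in lborel. 0 \<le> f (- x)"
    using AE_borel_affine[of "-1" "\<lambda>x. 0 \<le> f x" 0] f0 by simp
  moreover have "(\<integral>\<^sup>+x. ennreal (f (- x)) \<partial>lborel) = 1"
    using nn1 by (subst (asm) nn_integral_real_affine[of _ "-1" 0]) auto
  ultimately have "AE x in lborel. ennreal (f (- x)) = ennreal (f x)"
    by (subst (asm) finite_density_unique) auto
  then show ?thesis
    using f0 \<open>AE x in lborel. 0 \<le> f (- x)\<close> by eventually_elim simp
qed

text \<open>The kernel determines the symbol only almost everywhere. Continuity is what permits evaluating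
  the identity at single points, in particular at \<open>0\<close>.\<close>

lemma fourier_eq_symbol_at:
  assumes K: "integrable lborel K" and eq: "AE \<xi> in lborel. fourier K \<xi> = complex_of_real (m \<xi>)"
    and m: "isCont m \<xi>"
  shows "fourier K \<xi> = complex_of_real (m \<xi>)"
proof (rule ccontr)
  define g where "g = (\<lambda>\<xi>. fourier K \<xi> - complex_of_real (m \<xi>))"
  assume "\<not> ?thesis"
  then have "g \<xi> \<noteq> 0" by (simp add: g_def)
  moreover have "isCont g \<xi>" unfolding g_def using m by (intro continuous_intros isCont_fourier[OF K])
  ultimately obtain e where e: "e > 0" "\<And>y. dist \<xi> y < e \<Longrightarrow> g y \<noteq> 0"
    using continuous_at_avoid[of \<xi> g 0] by auto
  obtain y where "\<xi> < y" "y < \<xi> + e" "g y = 0"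
    using AE_lborel_ex_between[OF eq, of \<xi> "\<xi> + e"] e by (auto simp: g_def)
  then show False using e(2)[of y] by (auto simp: dist_real_def)
qed

lemma fourier_real:
  assumes K: "integrable lborel K" and eq: "AE \<xi> in lborel. fourier K \<xi> = complex_of_real (m \<xi>)"
  shows "Im (fourier K \<xi>) = 0"
proof -
  have "AE \<xi> in lborel. fourier K \<xi> = complex_of_real (Re (fourier K \<xi>))"
    using eq by eventually_elim simp
  moreover have "isCont (\<lambda>\<xi>. Re (fourier K \<xi>)) \<xi>"
    by (intro isCont_Re isCont_fourier[OF K])
  ultimately have "fourier K \<xi> = complex_of_real (Re (fourier K \<xi>))"
    by (rule fourier_eq_symbol_at[OF K])
  then show ?thesis by (metis Im_complex_of_real)
qed

text \<open>For nonnegative \<open>K\<close> this identifies the norm of \<open>L\<close> on bounded functions with \<open>m 0\<close>, which is how the supercritical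
  speed enters.\<close>

lemma kernel_mass:
  assumes A1: "dispersion_assms m K l"
  shows "(LINT x|lborel. K x) / sqrt (2 * pi) = m 0"
proof -
  obtain e where "e > 0" and Ck: "Ck_on (2 * l) m (ball 0 e)" and l: "l \<ge> 1"
    using A1 unfolding dispersion_assms_def by auto
  have "((deriv ^^ 0) m) differentiable (at 0)"
    using Ck l \<open>e > 0\<close> unfolding Ck_on_def by (metis centre_in_ball mult_pos_pos zero_less_numeral less_le_trans zero_less_one)
  then have "isCont m 0" by (simp add: differentiable_imp_continuous_within)
  then have "fourier K 0 = complex_of_real (m 0)"
    using A1 unfolding dispersion_assms_def by (intro fourier_eq_symbol_at) auto
  then show ?thesis
    unfolding fourier_def by (simp del: of_real_mult of_real_divide flip: of_real_mult of_real_divide)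
qed

lemma kernel_even:
  assumes A1: "dispersion_assms m K l" and K0: "AE x in lborel. 0 \<le> K x"
  shows "AE x in lborel. K (- x) = K x"
proof -
  have K: "integrable lborel K" and eq: "AE \<xi> in lborel. fourier K \<xi> = complex_of_real (m \<xi>)"
    and m0: "m 0 > 0"
    using A1 by (auto simp: dispersion_assms_def)
  define A where "A = (LINT x|lborel. K x)"
  have A: "A > 0" using kernel_mass[OF A1] m0 by (simp add: A_def field_simps)
  have "Im (CLINT x|lborel. complex_of_real (K x / A) * iexp (t * x)) = 0" for t
  proof -
    have "(CLINT x|lborel. complex_of_real (K x / A) * iexp (t * x))
        = (CLINT x|lborel. complex_of_real (1 / A) *
            (complex_of_real (K x) * exp (- \<i> * complex_of_real (- t * x))))"
      by (rule Bochner_Integration.integral_cong) (auto simp: mult_ac)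
    also have "\<dots> = complex_of_real (1 / A) *
        (CLINT x|lborel. complex_of_real (K x) * exp (- \<i> * complex_of_real (- t * x)))"
      by (rule integral_mult_right_zero)
    also have "\<dots> = complex_of_real (sqrt (2 * pi) / A) * fourier K (- t)"
      unfolding fourier_def by simp
    finally have scaled: "(CLINT x|lborel. complex_of_real (K x / A) * iexp (t * x))
        = complex_of_real (sqrt (2 * pi) / A) * fourier K (- t)" .
    show ?thesis unfolding scaled by (simp del: of_real_divide add: fourier_real[OF K eq])
  qed
  then have "AE x in lborel. K (- x) / A = K x / A"
    using K K0 A by (intro even_if_char_real) (auto simp: A_def elim!: eventually_mono)
  then show ?thesis using A by simp
qed

section \<open>The maximum principle\<close>

lemma integrable_conv:
  fixes K u :: "real \<Rightarrow> real"
  assumes K: "integrable lborel K" and [measurable]: "u \<in> borel_measurable borel"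
    and B: "AE x in lborel. \<bar>u x\<bar> \<le> B"
  shows "integrable lborel (\<lambda>y. K (x - y) * u y)"
proof -
  have K': "integrable lborel (\<lambda>y. K (x - y))"
    using lborel_integrable_real_affine[OF K, of "-1" x] by simp
  show ?thesis
  proof (rule Bochner_Integration.integrable_bound)
    show "integrable lborel (\<lambda>y. B * K (x - y))" using K' by simp
    show "(\<lambda>y. K (x - y) * u y) \<in> borel_measurable lborel" using K' by auto
    show "AE y in lborel. norm (K (x - y) * u y) \<le> norm (B * K (x - y))"
      using B by eventually_elim
        (auto simp: abs_mult mult.commute intro!: mult_right_mono)
  qed
qed

text \<open>Each application of the inequality improves the lower bound by the factor \<open>c / \<nu> < 1\<close>,
  where \<open>c\<close> is the norm of \<open>L\<close>.\<close>

lemma supersolution_nonneg: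
  fixes K u :: "real \<Rightarrow> real"
  assumes K: "integrable lborel K" and K0: "AE x in lborel. 0 \<le> K x"
    and \<nu>: "(LINT x|lborel. K x) / sqrt (2 * pi) < \<nu>"
    and u[measurable]: "u \<in> borel_measurable borel" and B: "AE x in lborel. \<bar>u x\<bar> \<le> B"
    and super: "AE x in lborel. conv_op K u x \<le> \<nu> * u x"
  shows "AE x in lborel. 0 \<le> u x"
proof -
  have [measurable]: "K \<in> borel_measurable borel" using K by auto
  define c where "c = (LINT x|lborel. K x) / sqrt (2 * pi)"
  have c: "0 \<le> c" unfolding c_def using K0 by (simp add: integral_nonneg_AE)
  then have \<nu>0: "0 < \<nu>" and c\<nu>: "c < \<nu>" using \<nu> by (auto simp: c_def)
  have int_refl: "(LINT y|lborel. K (x - y)) = (LINT y|lborel. K y)" for x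
    by (subst (2) lborel_integral_real_affine[of "-1" _ x]) auto
  have improve: "AE x in lborel. - (c / \<nu> * b) \<le> u x" if b: "AE x in lborel. - b \<le> u x" for b
  proof -
    have lower: "- (c * b) \<le> conv_op K u x" for x
    proof -
      have K0x: "AE y in lborel. 0 \<le> K (x - y)"
        using AE_borel_affine[of "-1" "\<lambda>x. 0 \<le> K x" x] K0 by simp
      have "(LINT y|lborel. K (x - y) * (- b)) \<le> (LINT y|lborel. K (x - y) * u y)"
      proof (rule integral_mono_AE)
        show "integrable lborel (\<lambda>y. K (x - y) * (- b))"
          using lborel_integrable_real_affine[OF K, of "-1" x] by simp
        show "integrable lborel (\<lambda>y. K (x - y) * u y)" by (rule integrable_conv[OF K u B])
        show "AE y in lborel. K (x - y) * (- b) \<le> K (x - y) * u y"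
          using K0x b by eventually_elim (rule mult_left_mono)
      qed
      then have "1 / sqrt (2 * pi) * ((LINT y|lborel. K y) * (- b)) \<le> conv_op K u x"
        unfolding conv_op_def by (intro mult_left_mono) (auto simp: int_refl)
      then show ?thesis by (simp add: c_def)
    qed
    have "AE x in lborel. - (c * b) \<le> \<nu> * u x"
      using super by eventually_elim (rule order_trans[OF lower])
    then show ?thesis using \<nu>0 by (auto simp: field_simps elim!: eventually_mono)
  qed
  have "AE x in lborel. - ((c / \<nu>) ^ n * B) \<le> u x" for n
  proof (induction n)
    case 0
    show ?case using B by eventually_elim (simp add: abs_le_iff)
  next
    case (Suc n)
    show ?case using improve[OF Suc] by (simp add: mult.assoc)
  qed
  then have "AE x in lborel. \<forall>n. - ((c / \<nu>) ^ n * B) \<le> u x"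
    by (simp add: AE_all_countable)
  moreover have "(\<lambda>n. - ((c / \<nu>) ^ n * B)) \<longlonglongrightarrow> - (0 * B)"
    using c c\<nu> \<nu>0 by (intro tendsto_intros LIMSEQ_power_zero) auto
  then have "(\<forall>n. - ((c / \<nu>) ^ n * B) \<le> y) \<Longrightarrow> 0 \<le> y" for y
    using LIMSEQ_le_const2[of "\<lambda>n. - ((c / \<nu>) ^ n * B)" 0 y] by auto
  ultimately show ?thesis by (auto elim!: eventually_mono)
qed

text \<open>Once everything is nonnegative, the argument can be run with extended nonnegative integrals, where
  iterating the operator and exchanging integrals require no integrability.\<close>

lemma supersolution_zero_or_pos:
  fixes K u :: "real \<Rightarrow> real"
  assumes K: "integrable lborel K" and K0: "AE x in lborel. 0 \<le> K x"
    and Kpos: "(LINT x|lborel. K x) > 0" and even: "AE x in lborel. K (- x) = K x"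
    and u[measurable]: "u \<in> borel_measurable borel" and B: "AE x in lborel. \<bar>u x\<bar> \<le> B"
    and u0: "AE x in lborel. 0 \<le> u x"
    and super: "AE x in lborel. conv_op K u x \<le> \<nu> * u x"
  shows "(AE x in lborel. u x = 0) \<or> (AE x in lborel. 0 < u x)"
proof -
  have [measurable]: "K \<in> borel_measurable borel" using K by auto
  define k v where "k = (\<lambda>x. ennreal (K x))" and "v = (\<lambda>x. ennreal (u x))"
  have [measurable]: "k \<in> borel_measurable borel" "v \<in> borel_measurable borel"
    by (auto simp: k_def v_def)
  define C where "C = ennreal (sqrt (2 * pi) * \<nu>)"
  define T where "T = (\<lambda>w x. \<integral>\<^sup>+y. k (x - y) * w y \<partial>lborel)"
  have T_meas[measurable]: "T w \<in> borel_measurable borel" if [measurable]: "w \<in> borel_measurable borel" for w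
    unfolding T_def by measurable
  have Tv: "AE x in lborel. T v x \<le> C * v x"
    using super u0
  proof eventually_elim
    case (elim x)
    have K0x: "AE y in lborel. 0 \<le> K (x - y)"
      using AE_borel_affine[of "-1" "\<lambda>x. 0 \<le> K x" x] K0 by simp
    have "T v x = (\<integral>\<^sup>+y. ennreal (K (x - y) * u y) \<partial>lborel)"
      unfolding T_def k_def v_def
      by (rule nn_integral_cong_AE) (use u0 K0x in \<open>eventually_elim, simp add: ennreal_mult\<close>)
    also have "\<dots> = ennreal (LINT y|lborel. K (x - y) * u y)"
      using u0 K0x by (intro nn_integral_eq_integral integrable_conv[OF K u B]) auto
    also have "\<dots> = ennreal (sqrt (2 * pi) * conv_op K u x)"
      by (simp add: conv_op_def)
    also have "\<dots> \<le> ennreal (sqrt (2 * pi) * (\<nu> * u x))"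
      using elim by (intro ennreal_leI mult_left_mono) auto
    also have "\<dots> = C * v x"
      using elim by (simp add: C_def v_def ennreal_mult'' mult.assoc flip: ennreal_mult'')
    finally show ?case .
  qed
  have TTv: "AE x in lborel. T (T v) x \<le> C * (C * v x)"
    using Tv
  proof eventually_elim
    case (elim x)
    have "T (T v) x = (\<integral>\<^sup>+y. k (x - y) * T v y \<partial>lborel)" by (simp add: T_def)
    also have "\<dots> \<le> (\<integral>\<^sup>+y. k (x - y) * (C * v y) \<partial>lborel)"
      by (rule nn_integral_mono_AE) (use Tv in \<open>eventually_elim, simp add: mult_left_mono\<close>)
    also have "\<dots> = C * T v x"
      unfolding T_def by (subst nn_integral_cmult[symmetric]) (auto simp: ac_simps)
    also have "\<dots> \<le> C * (C * v x)"
      using elim by (intro mult_left_mono) auto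
    finally show ?case .
  qed
  (* The set where K is positive meets all its small translates. Since K is even, this says that
     the twofold kernel k2 x z is positive for z near x. *)
  define P where "P = {s. K s > 0}"
  have [measurable]: "P \<in> sets borel" by (simp add: P_def)
  have "emeasure lborel P \<noteq> 0"
  proof
    assume "emeasure lborel P = 0"
    then have "AE s in lborel. s \<notin> P" by (intro AE_not_in) (auto simp: null_sets_def)
    then have "AE s in lborel. K s = 0"
      using K0 by eventually_elim (auto simp: P_def)
    then have "(LINT s|lborel. K s) = 0" by (intro integral_eq_zero_AE) auto
    then show False using Kpos by simp
  qed
  then obtain r where r: "r > 0"
      and meets: "\<And>h. \<bar>h\<bar> < r \<Longrightarrow> \<not> (AE s in lborel. \<not> (s \<in> P \<and> s + h \<in> P))"
    using positive_measure_meets_translates[of P] by auto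
  define k2 where "k2 = (\<lambda>x z. \<integral>\<^sup>+y. k (x - y) * k (y - z) \<partial>lborel)"
  have k2_meas[measurable]: "(\<lambda>z. k2 x z) \<in> borel_measurable borel" for x
    unfolding k2_def by measurable
  have k2_pos: "k2 x z \<noteq> 0" if "\<bar>z - x\<bar> < r" for x z
  proof
    assume "k2 x z = 0"
    then have "AE y in lborel. k (x - y) * k (y - z) = 0"
      unfolding k2_def by (subst (asm) nn_integral_0_iff_AE) auto
    (* Substituting y = x - s turns the integrand into k s * k (- (s + (z - x))). *)
    then have "AE s in lborel. k (x - (x + (-1) * s)) * k ((x + (-1) * s) - z) = 0"
      by (intro AE_borel_affine) auto
    moreover have "AE s in lborel. K (- ((z - x) + 1 * s)) = K ((z - x) + 1 * s)"
      using even by (intro AE_borel_affine) auto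
    ultimately have "AE s in lborel. \<not> (s \<in> P \<and> s + (z - x) \<in> P)"
      by eventually_elim (auto simp: k_def P_def algebra_simps ennreal_eq_0_iff)
    then show False using meets[OF that] by blast
  qed
  have TT: "T (T v) x = (\<integral>\<^sup>+z. k2 x z * v z \<partial>lborel)" for x
  proof -
    have "T (T v) x = (\<integral>\<^sup>+y. \<integral>\<^sup>+z. k (x - y) * (k (y - z) * v z) \<partial>lborel \<partial>lborel)"
      unfolding T_def by (subst nn_integral_cmult) auto
    also have "\<dots> = (\<integral>\<^sup>+z. \<integral>\<^sup>+y. k (x - y) * (k (y - z) * v z) \<partial>lborel \<partial>lborel)"
      by (rule lborel_pair.Fubini') measurable
    also have "\<dots> = (\<integral>\<^sup>+z. k2 x z * v z \<partial>lborel)"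
      unfolding k2_def by (subst nn_integral_multc[symmetric]) (auto simp: ac_simps)
    finally show ?thesis .
  qed
  have "AE x in lborel. x \<in> {x. v x = 0} \<longrightarrow> (AE z in lborel. \<bar>z - x\<bar> < r \<longrightarrow> z \<in> {x. v x = 0})"
    using TTv
  proof eventually_elim
    case (elim x)
    show ?case
    proof
      assume "x \<in> {x. v x = 0}"
      then have "(\<integral>\<^sup>+z. k2 x z * v z \<partial>lborel) = 0" using elim by (simp add: TT)
      then have "AE z in lborel. k2 x z * v z = 0" by (subst (asm) nn_integral_0_iff_AE) auto
      then show "AE z in lborel. \<bar>z - x\<bar> < r \<longrightarrow> z \<in> {x. v x = 0}"
        by eventually_elim (use k2_pos in auto)
    qed
  qed
  from zero_set_spreads[OF r this] show ?thesis
  proof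
    assume "AE x in lborel. x \<in> {x. v x = 0}"
    then have "AE x in lborel. u x = 0"
      using u0 by eventually_elim (simp add: v_def ennreal_eq_0_iff)
    then show ?thesis ..
  next
    assume "AE x in lborel. x \<notin> {x. v x = 0}"
    then have "AE x in lborel. 0 < u x"
      by eventually_elim (simp add: v_def ennreal_eq_0_iff)
    then show ?thesis ..
  qed
qed


section \<open>The sign of the nonlinearity and of the solution\<close>

text \<open>The exponent \<open>1 / 2\<close> stands for any exponent below \<open>1\<close>. Such exponents are smaller than \<open>1 + q\<close>
  and have integer part \<open>0\<close>, so that the assumption on the remainder yields a bound for the
  remainder itself. The Hoelder bound on an interval needs a Lipschitz constant that is uniform
  there, which compactness supplies.\<close>

lemma locally_lipschitz_imp_holder_half:
  assumes "locally_lipschitz f"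
  shows "holder_loc (1 / 2) f"
proof -
  have loc: "local_lipschitz (UNIV :: real set) UNIV (\<lambda>t. f)"
  proof (rule local_lipschitzI)
    fix t x :: real
    obtain e L where e: "e > 0" "L-lipschitz_on (ball x e) f"
      using assms unfolding locally_lipschitz_def by blast
    have "cball x (e / 2) \<subseteq> ball x e" using e by auto
    then have "L-lipschitz_on (cball x (e / 2)) f" using e lipschitz_on_subset by blast
    then show "\<exists>u>0. \<exists>L. \<forall>t\<in>cball t u \<inter> UNIV. L-lipschitz_on (cball x u \<inter> UNIV) f"
      using e by (intro exI[of _ "e / 2"]) auto
  qed
  have cont: "continuous_on UNIV f"
    unfolding continuous_on_eq_continuous_at[OF open_UNIV]
  proof
    fix x
    obtain e L where e: "e > 0" "L-lipschitz_on (ball x e) f"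
      using assms unfolding locally_lipschitz_def by blast
    then have "continuous_on (ball x e) f" by (blast intro: lipschitz_on_continuous_on)
    then show "isCont f x" using e by (simp add: continuous_on_eq_continuous_at)
  qed
  have "\<exists>C. \<forall>x\<in>{-R..R}. \<forall>y\<in>{-R..R}. \<bar>f x - f y\<bar> \<le> C * \<bar>x - y\<bar> powr (1 / 2)" for R
  proof -
    have "local_lipschitz {0::real} {-R..R} (\<lambda>t. f)"
      using loc by (rule local_lipschitz_subset) auto
    then obtain L where L: "L-lipschitz_on {-R..R} f"
      by (rule local_lipschitz_compact_implies_lipschitz[where T = "{0}" and X = "{-R..R}"]) auto
    have "\<bar>f x - f y\<bar> \<le> L * sqrt (2 * R) * \<bar>x - y\<bar> powr (1 / 2)"
      if "x \<in> {-R..R}" "y \<in> {-R..R}" for x y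
    proof -
      have "\<bar>x - y\<bar> \<le> 2 * R" using that by auto
      then have "sqrt \<bar>x - y\<bar> * sqrt \<bar>x - y\<bar> \<le> sqrt (2 * R) * sqrt \<bar>x - y\<bar>"
        by (intro mult_right_mono real_sqrt_le_mono) auto
      then have "\<bar>x - y\<bar> \<le> sqrt (2 * R) * sqrt \<bar>x - y\<bar>" by simp
      then have "L * \<bar>x - y\<bar> \<le> L * (sqrt (2 * R) * sqrt \<bar>x - y\<bar>)"
        using lipschitz_on_nonneg[OF L] by (rule mult_left_mono)
      moreover have "\<bar>f x - f y\<bar> \<le> L * \<bar>x - y\<bar>"
        using lipschitz_onD[OF L that] by (simp add: dist_real_def)
      ultimately show ?thesis by (simp add: powr_half_sqrt mult.assoc)
    qed
    then show ?thesis by blast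
  qed
  with cont show ?thesis by (simp add: holder_loc_def Ck_on_def)
qed

lemma nq_times_coefficient:
  assumes "nq = nq_even \<gamma> q \<or> nq = nq_odd \<gamma> q \<and> 0 \<le> x"
  shows "\<gamma> * nq x = \<gamma>\<^sup>2 * \<bar>x\<bar> powr (1 + q)"
proof (cases "x = 0")
  case False
  with assms show ?thesis
    by (auto simp: nq_even_def nq_odd_def powr_add power2_eq_square)
qed (use assms in \<open>auto simp: nq_even_def nq_odd_def\<close>)

text \<open>For small nonzero \<open>x\<close> the remainder is at most \<open>\<bar>\<gamma>\<bar> * \<bar>x\<bar> powr (1 + q)\<close>, the modulus of the
  leading term. At \<open>x = 0\<close> the remainder estimate says nothing, and the sign comes from the
  continuity of \<open>n\<close>.\<close>

lemma nonlinearity_sign_near_0: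
  assumes A2: "nonlinearity_assms n nq \<gamma> q l"
  shows "\<exists>\<delta>>0. \<forall>x. \<bar>x\<bar> < \<delta> \<and> (nq = nq_odd \<gamma> q \<longrightarrow> 0 \<le> x) \<longrightarrow> 0 \<le> \<gamma> * n x"
proof -
  have q: "0 < q" and \<gamma>: "\<gamma> \<noteq> 0" and nq: "nq = nq_even \<gamma> q \<or> nq = nq_odd \<gamma> q"
    and lip: "locally_lipschitz n"
    and small: "\<And>s. 0 < s \<Longrightarrow> s < 1 + q \<Longrightarrow> holder_loc s n \<Longrightarrow>
        (\<forall>j\<le>nat \<lfloor>s\<rfloor>. (deriv ^^ j) (\<lambda>x. n x - nq x) \<in> o[at 0](\<lambda>x. \<bar>x\<bar> powr (1 + q - real j)))"
    using A2 unfolding nonlinearity_assms_def by auto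
  have holder: "holder_loc (1 / 2) n" by (rule locally_lipschitz_imp_holder_half[OF lip])
  have "(\<lambda>x. n x - nq x) \<in> o[at 0](\<lambda>x. \<bar>x\<bar> powr (1 + q))"
    using small[of "1 / 2"] holder q by simp
  then have "\<forall>\<^sub>F x in at 0. \<bar>n x - nq x\<bar> \<le> \<bar>\<gamma>\<bar> * \<bar>x\<bar> powr (1 + q)"
    using landau_o.smallD[of _ "at 0" _ "\<bar>\<gamma>\<bar>"] \<gamma> by fastforce
  then obtain \<delta> where \<delta>: "\<delta> > 0"
      and bound: "\<And>x. x \<noteq> 0 \<Longrightarrow> \<bar>x\<bar> < \<delta> \<Longrightarrow> \<bar>n x - nq x\<bar> \<le> \<bar>\<gamma>\<bar> * \<bar>x\<bar> powr (1 + q)"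
    unfolding eventually_at by (auto simp: dist_real_def)
  have nonzero: "0 \<le> \<gamma> * n x" if "x \<noteq> 0" "\<bar>x\<bar> < \<delta>" "nq = nq_odd \<gamma> q \<longrightarrow> 0 \<le> x" for x
  proof -
    have "\<bar>\<gamma> * (n x - nq x)\<bar> \<le> \<bar>\<gamma>\<bar> * (\<bar>\<gamma>\<bar> * \<bar>x\<bar> powr (1 + q))"
      unfolding abs_mult using bound that by (intro mult_left_mono) auto
    also have "\<dots> = \<gamma> * nq x"
      using nq that by (subst nq_times_coefficient[of _ \<gamma> q]) (auto simp: power2_eq_square)
    finally show ?thesis by (simp add: algebra_simps abs_le_iff)
  qed
  have "0 \<le> \<gamma> * n 0"
  proof -
    have "isCont n 0"
      using holder by (auto simp: holder_loc_def Ck_on_def continuous_on_eq_continuous_at)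
    then have "((\<lambda>x. \<gamma> * n x) \<longlongrightarrow> \<gamma> * n 0) (at_right 0)"
      by (intro tendsto_intros) (auto simp: isCont_def filterlim_at_split)
    moreover have "\<forall>\<^sub>F x in at_right 0. 0 \<le> \<gamma> * n x"
      unfolding eventually_at_right_field using \<delta> nonzero by (intro exI[of _ \<delta>]) auto
    ultimately show ?thesis by (intro tendsto_lowerbound) auto
  qed
  then have "\<forall>x. \<bar>x\<bar> < \<delta> \<and> (nq = nq_odd \<gamma> q \<longrightarrow> 0 \<le> x) \<longrightarrow> 0 \<le> \<gamma> * n x"
    using nonzero by metis
  then show ?thesis using \<delta> by blast
qed

lemma AE_le_Linf_norm: "AE x in lborel. ereal \<bar>u x\<bar> \<le> Linf_norm u"
  unfolding Linf_norm_def by (rule esssup_AE)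

text \<open>Multiplying the equation by \<open>sgn \<gamma>\<close> makes the nonlinear term nonnegative for either sign of
  \<open>\<gamma>\<close>, so that dropping it leaves a supersolution.\<close>

lemma solution_sign:
  assumes A1: "dispersion_assms m K l" and K0: "AE x in lborel. 0 \<le> K x"
    and \<nu>: "\<nu> > m 0" and sol: "bounded_solution K n \<nu> u" and nz: "\<not> (AE x in lborel. u x = 0)"
    and \<gamma>: "\<gamma> \<noteq> 0" and sign: "AE x in lborel. 0 \<le> \<gamma> * n (u x)"
  shows "AE x in lborel. sgn (u x) = sgn \<gamma>"
proof -
  have K: "integrable lborel K" and m0: "m 0 > 0"
    using A1 by (auto simp: dispersion_assms_def)
  have [measurable]: "u \<in> borel_measurable borel" and fin: "Linf_norm u < \<infinity>"
    and eq: "AE x in lborel. conv_op K u x - \<nu> * u x + n (u x) = 0"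
    using sol by (auto simp: bounded_solution_def)
  define w where "w = (\<lambda>x. sgn \<gamma> * u x)"
  have w[measurable]: "w \<in> borel_measurable borel" unfolding w_def by simp
  obtain B where B: "Linf_norm u \<le> ereal B" using fin by (cases "Linf_norm u") auto
  have w_bound: "AE x in lborel. \<bar>w x\<bar> \<le> B"
    using AE_le_Linf_norm[of u]
  proof eventually_elim
    case (elim x)
    then have "\<bar>u x\<bar> \<le> B" using B order_trans by fastforce
    then show ?case using \<gamma> by (simp add: w_def abs_mult abs_sgn_eq)
  qed
  have conv_w: "conv_op K w x = sgn \<gamma> * conv_op K u x" for x
    unfolding conv_op_def w_def by (simp add: mult.left_commute)
  have super: "AE x in lborel. conv_op K w x \<le> \<nu> * w x"
    using eq sign
  proof eventually_elim
    case (elim x)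
    have "0 \<le> sgn \<gamma> * n (u x)" using elim(2) by (auto simp: sgn_real_def zero_le_mult_iff)
    moreover have "sgn \<gamma> * (conv_op K u x - \<nu> * u x + n (u x)) = 0" using elim(1) by simp
    moreover have "w x = sgn \<gamma> * u x" by (simp add: w_def)
    ultimately show ?case by (simp add: conv_w algebra_simps)
  qed
  have mass: "(LINT x|lborel. K x) / sqrt (2 * pi) < \<nu>" using kernel_mass[OF A1] \<nu> by simp
  have pos: "(LINT x|lborel. K x) > 0" using kernel_mass[OF A1] m0 by (simp add: field_simps)
  have "AE x in lborel. 0 \<le> w x"
    by (rule supersolution_nonneg[OF K K0 mass w w_bound super])
  then have "(AE x in lborel. w x = 0) \<or> (AE x in lborel. 0 < w x)"
    by (rule supersolution_zero_or_pos[OF K K0 pos kernel_even[OF A1 K0] w w_bound _ super])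
  moreover have "\<not> (AE x in lborel. w x = 0)"
    using nz \<gamma> by (simp add: w_def sgn_eq_0_iff)
  ultimately have "AE x in lborel. 0 < w x" by blast
  then show ?thesis
    by eventually_elim (auto simp: w_def sgn_real_def zero_less_mult_iff split: if_splits)
qed

theorem theorem7p2:
  fixes m K n nq :: "real \<Rightarrow> real" and \<gamma> q :: real and l :: nat
  assumes A1: "dispersion_assms m K l"
    and A2: "nonlinearity_assms n nq \<gamma> q l"
    and K_nonneg: "AE x in lborel. 0 \<le> K x"
  shows "(n = nq \<longrightarrow>
           (\<forall>\<nu> u. \<nu> > m 0 \<and> bounded_solution K n \<nu> u \<and> \<not> (AE x in lborel. u x = 0) \<and>
                  (nq = nq_odd \<gamma> q \<longrightarrow> (AE x in lborel. 0 \<le> u x))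
              \<longrightarrow> (AE x in lborel. sgn (u x) = sgn \<gamma>))) \<and>
         (\<exists>\<delta>>0. \<forall>\<nu> u. \<nu> > m 0 \<and> bounded_solution K n \<nu> u \<and> \<not> (AE x in lborel. u x = 0) \<and>
                  (nq = nq_odd \<gamma> q \<longrightarrow> (AE x in lborel. 0 \<le> u x)) \<and> Linf_norm u < ereal \<delta>
              \<longrightarrow> (AE x in lborel. sgn (u x) = sgn \<gamma>))"
proof -
  have \<gamma>: "\<gamma> \<noteq> 0" and nq: "nq = nq_even \<gamma> q \<or> nq = nq_odd \<gamma> q"
    using A2 unfolding nonlinearity_assms_def by auto
  have homogeneous: "AE x in lborel. sgn (u x) = sgn \<gamma>"
    if "n = nq" "\<nu> > m 0" "bounded_solution K n \<nu> u" "\<not> (AE x in lborel. u x = 0)"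
      and u0: "nq = nq_odd \<gamma> q \<longrightarrow> (AE x in lborel. 0 \<le> u x)" for \<nu> u
  proof (rule solution_sign[OF A1 K_nonneg that(2-4) \<gamma>])
    have "AE x in lborel. nq = nq_odd \<gamma> q \<longrightarrow> 0 \<le> u x" using u0 by auto
    then show "AE x in lborel. 0 \<le> \<gamma> * n (u x)"
      by eventually_elim
        (use nq \<open>n = nq\<close> in \<open>subst \<open>n = nq\<close>, subst nq_times_coefficient[of _ \<gamma> q], auto\<close>)
  qed
  obtain \<delta> where \<delta>: "\<delta> > 0"
      and near0: "\<And>x. \<bar>x\<bar> < \<delta> \<Longrightarrow> (nq = nq_odd \<gamma> q \<longrightarrow> 0 \<le> x) \<Longrightarrow> 0 \<le> \<gamma> * n x"
    using nonlinearity_sign_near_0[OF A2] by blast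
  have small: "AE x in lborel. sgn (u x) = sgn \<gamma>"
    if "\<nu> > m 0" "bounded_solution K n \<nu> u" "\<not> (AE x in lborel. u x = 0)"
      and u0: "nq = nq_odd \<gamma> q \<longrightarrow> (AE x in lborel. 0 \<le> u x)"
      and norm: "Linf_norm u < ereal \<delta>" for \<nu> u
  proof (rule solution_sign[OF A1 K_nonneg that(1-3) \<gamma>])
    have "AE x in lborel. nq = nq_odd \<gamma> q \<longrightarrow> 0 \<le> u x" using u0 by auto
    then show "AE x in lborel. 0 \<le> \<gamma> * n (u x)"
      using AE_le_Linf_norm[of u]
    proof eventually_elim
      case (elim x)
      have "ereal \<bar>u x\<bar> < ereal \<delta>" using elim(2) norm by (rule order_le_less_trans)
      then show ?case using elim(1) near0 by simp
    qed
  qed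
  show ?thesis using homogeneous small \<delta> by blast
qed

end
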